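(* Let $C_0>0$, let $K\ge0$ be a fixed integer, and let $\{\alpha_k\},\{\beta_k\},\{\gamma_k\}$ be the parameter sequences of algorithm $(\mathcal B')$ (defined in the context). There exists a constant $C>0$, depending only on $C_0$, $K$ and $\{\alpha_k\},\{\beta_k\},\{\gamma_k\}$, such that for all $L>0$, all $f\in\mathcal F^1_L$, all $x_0\in\mathbb R^n$ and all $0<s\le C_0/L$, the iterates of $(\mathcal B')$ satisfy $$s(f(x_K)-f^* )\le C\|x_0-x^*\|^2,\qquad s^2\|\nabla f(x_K)\|^2\le C\|x_0-x^*\|^2,\qquad\|z_{K+1}-x^*\|^2\le C\|x_0-x^*\|^2.$$
   Context: $\mathcal F^1_L$ is the set of continuously differentiable convex functions $f:\mathbb R^n\to\mathbb R$ that are $L$-smooth ($\|\nabla f(y)-\nabla f(x)\|\le L\|y-x\|$ for all $x,y$, Euclidean norm). It is assumed throughout that $f$ has a minimizer; $x^*$ denotes one of the minimizers and $f^*=f(x^* )$. Algorithm $(\mathcal B')$: given real sequences $\{\alpha_k\}_{k\ge0}$ (nonzero, so that the recursion is defined), $\{\beta_k\}_{k\ge0}$, $\{\gamma_k\}_{k\ge0}$, put $\widetilde\alpha_k=\beta_k\alpha_k+(\gamma_k-\beta_k)\alpha_{k+1}$; starting from $x_0=z_0\in\mathbb R^n$, for $k\ge0$, $$y_{k+1}=x_k-\beta_ks\nabla f(x_k),\qquad z_{k+1}=z_k-\widetilde\alpha_ks\nabla f(x_k),\qquad x_{k+1}=\frac1{\alpha_{k+1}}z_{k+1}+\Big(1-\frac1{\alpha_{k+1}}\Big)y_{k+1}.$$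 *)

theory Defs
  imports "HOL-Analysis.Analysis" "HOL-Library.Function_Algebras"
begin

text \<open>
  The constant of the theorem must not depend on the dimension \<open>n\<close>, so \<open>n\<close> has to be quantified
  inside the formula and cannot be a type.  As in the library's \<^const>\<open>Euclidean_space\<close>,
  \<open>n\<close>-dimensional Euclidean space consists of the sequences \<open>nat \<Rightarrow> real\<close> that vanish from
  index \<open>n\<close> on.  The vector space operations are pointwise; on this carrier the type-class topology
  of functions (pointwise convergence) is the Euclidean topology.  The type-class metric of functions
  is not Euclidean and is not used.
\<close>

instantiation "fun" :: (type, real_vector) real_vector
begin

definition scaleR_fun :: "real \<Rightarrow> ('a \<Rightarrow> 'b) \<Rightarrow> 'a \<Rightarrow> 'b"
  where "scaleR_fun c f = (\<lambda>x. c *\<^sub>R f x)"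

instance
  by standard (auto simp: scaleR_fun_def scaleR_add_right scaleR_add_left)

end

lemma scaleR_fun_apply [simp]: "(c *\<^sub>R f) x = c *\<^sub>R f x"
  by (simp add: scaleR_fun_def)

abbreviation Rn :: "nat \<Rightarrow> (nat \<Rightarrow> real) set"
  where "Rn n \<equiv> topspace (Euclidean_space n)"

definition innern :: "nat \<Rightarrow> (nat \<Rightarrow> real) \<Rightarrow> (nat \<Rightarrow> real) \<Rightarrow> real"
  where "innern n x y = (\<Sum>i<n. x i * y i)"

definition normn :: "nat \<Rightarrow> (nat \<Rightarrow> real) \<Rightarrow> real"
  where "normn n x = sqrt (innern n x x)"

text \<open>
  Frechet differentiability, with the derivative represented by the gradient vector.  All notions
  below depend only on the restriction of \<open>f\<close> to \<^term>\<open>Rn n\<close>.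
\<close>

definition has_gradient :: "nat \<Rightarrow> ((nat \<Rightarrow> real) \<Rightarrow> real) \<Rightarrow> (nat \<Rightarrow> real) \<Rightarrow> (nat \<Rightarrow> real) \<Rightarrow> bool"
  where "has_gradient n f g x \<longleftrightarrow> g \<in> Rn n \<and>
    ((\<lambda>y. (f y - f x - innern n g (y - x)) / normn n (y - x)) \<longlongrightarrow> 0) (at x within Rn n)"

definition gradient :: "nat \<Rightarrow> ((nat \<Rightarrow> real) \<Rightarrow> real) \<Rightarrow> (nat \<Rightarrow> real) \<Rightarrow> (nat \<Rightarrow> real)"
  where "gradient n f x = (THE g. has_gradient n f g x)"

lemma has_gradient_unique:
  assumes x: "x \<in> Rn n" and g: "has_gradient n f g x" and g': "has_gradient n f g' x"
  shows "g = g'"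
proof (rule ccontr)
  assume "g \<noteq> g'"
  define h where "h = g' - g"
  have hR: "h \<in> Rn n"
    using g g' by (simp add: h_def has_gradient_def topspace_Euclidean_space)
  have h0: "h \<noteq> 0"
    using \<open>g \<noteq> g'\<close> by (simp add: h_def)
  from h0 obtain j where "h j \<noteq> 0"
    by (auto simp: fun_eq_iff)
  with hR have j: "j < n" "h j \<noteq> 0"
    by (auto simp: topspace_Euclidean_space not_le[symmetric])
  have "innern n h h > 0"
    unfolding innern_def by (rule sum_pos2[of _ j]) (use j in \<open>auto simp: zero_less_mult_iff\<close>)
  have "((\<lambda>y. (f y - f x - innern n g (y - x)) / normn n (y - x) -
      (f y - f x - innern n g' (y - x)) / normn n (y - x)) \<longlongrightarrow> 0 - 0) (at x within Rn n)"
    using g g' unfolding has_gradient_def by (intro tendsto_diff) auto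
  moreover have "(\<lambda>y. (f y - f x - innern n g (y - x)) / normn n (y - x) -
      (f y - f x - innern n g' (y - x)) / normn n (y - x)) = (\<lambda>y. innern n h (y - x) / normn n (y - x))"
    by (auto simp: fun_eq_iff h_def innern_def diff_divide_distrib[symmetric] left_diff_distrib sum_subtractf)
  ultimately have lim: "((\<lambda>y. innern n h (y - x) / normn n (y - x)) \<longlongrightarrow> 0) (at x within Rn n)"
    by simp
  have "continuous_on UNIV (\<lambda>t::real. x + t *\<^sub>R h)"
    by (intro continuous_on_coordinatewise_then_product) (auto intro!: continuous_intros)
  then have "((\<lambda>t. x + t *\<^sub>R h) \<longlongrightarrow> x + 0 *\<^sub>R h) (at 0)"
    by (simp add: continuous_on_def del: scaleR_zero_left)
  then have "((\<lambda>t. x + t *\<^sub>R h) \<longlongrightarrow> x) (at_right 0)"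
    by (auto intro: tendsto_mono[OF at_le])
  moreover have "eventually (\<lambda>t::real. x + t *\<^sub>R h \<in> Rn n \<and> x + t *\<^sub>R h \<noteq> x) (at_right 0)"
    using x hR h0 by (auto simp: eventually_at_filter topspace_Euclidean_space)
  ultimately have "filterlim (\<lambda>t. x + t *\<^sub>R h) (at x within Rn n) (at_right 0)"
    by (auto simp: filterlim_at elim: eventually_mono)
  from filterlim_compose[OF lim this]
  have "((\<lambda>t. innern n h (t *\<^sub>R h) / normn n (t *\<^sub>R h)) \<longlongrightarrow> 0) (at_right 0)"
    by simp
  moreover have "eventually (\<lambda>t. innern n h (t *\<^sub>R h) / normn n (t *\<^sub>R h) = normn n h) (at_right 0)"
  proof -
    have "innern n h (t *\<^sub>R h) / normn n (t *\<^sub>R h) = normn n h" if "t > 0" for t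
    proof -
      have "innern n h (t *\<^sub>R h) = t * innern n h h" "innern n (t *\<^sub>R h) (t *\<^sub>R h) = t\<^sup>2 * innern n h h"
        by (simp_all add: innern_def sum_distrib_left power2_eq_square algebra_simps)
      then show ?thesis
        using that \<open>innern n h h > 0\<close> by (simp add: normn_def real_sqrt_mult real_div_sqrt)
    qed
    then show ?thesis by (auto simp: eventually_at_filter)
  qed
  ultimately have "((\<lambda>t::real. normn n h) \<longlongrightarrow> 0) (at_right 0)"
    using tendsto_cong by fast
  then have "normn n h = 0" by (simp add: tendsto_const_iff)
  then show False using \<open>innern n h h > 0\<close> by (simp add: normn_def)
qed

lemma gradient_eqI: "x \<in> Rn n \<Longrightarrow> has_gradient n f g x \<Longrightarrow> gradient n f x = g"
  unfolding gradient_def by (blast intro: has_gradient_unique)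

definition C1_function :: "nat \<Rightarrow> ((nat \<Rightarrow> real) \<Rightarrow> real) \<Rightarrow> bool"
  where "C1_function n f \<longleftrightarrow>
    (\<forall>x\<in>Rn n. \<exists>g. has_gradient n f g x) \<and> continuous_on (Rn n) (gradient n f)"

definition F1 :: "nat \<Rightarrow> real \<Rightarrow> ((nat \<Rightarrow> real) \<Rightarrow> real) set"
  where "F1 n L = {f. C1_function n f \<and> convex_on (Rn n) f \<and>
    (\<forall>x\<in>Rn n. \<forall>y\<in>Rn n. normn n (gradient n f y - gradient n f x) \<le> L * normn n (y - x))}"

definition is_minimizer :: "nat \<Rightarrow> ((nat \<Rightarrow> real) \<Rightarrow> real) \<Rightarrow> (nat \<Rightarrow> real) \<Rightarrow> bool"
  where "is_minimizer n f xs \<longleftrightarrow> xs \<in> Rn n \<and> (\<forall>x\<in>Rn n. f xs \<le> f x)"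

definition alpha_tilde :: "(nat \<Rightarrow> real) \<Rightarrow> (nat \<Rightarrow> real) \<Rightarrow> (nat \<Rightarrow> real) \<Rightarrow> nat \<Rightarrow> real"
  where "alpha_tilde \<alpha> \<beta> \<gamma> k = \<beta> k * \<alpha> k + (\<gamma> k - \<beta> k) * \<alpha> (Suc k)"

text \<open>The value \<open>y 0\<close> is not part of the algorithm and is left unconstrained.\<close>

definition iterates_B' ::
  "nat \<Rightarrow> (nat \<Rightarrow> real) \<Rightarrow> (nat \<Rightarrow> real) \<Rightarrow> (nat \<Rightarrow> real) \<Rightarrow> real \<Rightarrow> ((nat \<Rightarrow> real) \<Rightarrow> real) \<Rightarrow>
   (nat \<Rightarrow> nat \<Rightarrow> real) \<Rightarrow> (nat \<Rightarrow> nat \<Rightarrow> real) \<Rightarrow> (nat \<Rightarrow> nat \<Rightarrow> real) \<Rightarrow> bool"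
  where "iterates_B' n \<alpha> \<beta> \<gamma> s f x y z \<longleftrightarrow>
    x 0 \<in> Rn n \<and> z 0 = x 0 \<and>
    (\<forall>k. y (Suc k) = x k - (\<beta> k * s) *\<^sub>R gradient n f (x k) \<and>
         z (Suc k) = z k - (alpha_tilde \<alpha> \<beta> \<gamma> k * s) *\<^sub>R gradient n f (x k) \<and>
         x (Suc k) = (1 / \<alpha> (Suc k)) *\<^sub>R z (Suc k) + (1 - 1 / \<alpha> (Suc k)) *\<^sub>R y (Suc k))"

end

theory Submission
  imports Defs
begin

text \<open>
  The gradient vanishes at \<open>x\<^sup>*\<close>, so smoothness gives \<open>s \<parallel>\<nabla>f(x)\<parallel> \<le> C\<^sub>0 \<parallel>x - x\<^sup>*\<parallel>\<close> for every \<open>x\<close>.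
  Hence each step of the algorithm increases the distances of \<open>x\<^sub>k\<close> and \<open>z\<^sub>k\<close> to \<open>x\<^sup>*\<close> at most by a
  factor depending only on the parameters and on \<open>C\<^sub>0\<close>.  The function values are then controlled by
  the first-order convexity inequality \<open>f(x) - f(x\<^sup>*) \<le> \<langle>\<nabla>f(x), x - x\<^sup>*\<rangle>\<close> and Cauchy-Schwarz.
\<close>

section \<open>Linear structure, norm and Cauchy-Schwarz inequality on \<open>Rn n\<close>\<close>

lemma Rn_iff: "x \<in> Rn n \<longleftrightarrow> (\<forall>i\<ge>n. x i = 0)"
  by (simp add: topspace_Euclidean_space)

lemma Rn_add: "x \<in> Rn n \<Longrightarrow> y \<in> Rn n \<Longrightarrow> x + y \<in> Rn n"
  and Rn_diff: "x \<in> Rn n \<Longrightarrow> y \<in> Rn n \<Longrightarrow> x - y \<in> Rn n"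
  and Rn_scaleR: "x \<in> Rn n \<Longrightarrow> c *\<^sub>R x \<in> Rn n"
  by (simp_all add: Rn_iff)

lemma normn_eq_L2_set: "normn n x = L2_set x {..<n}"
  by (simp add: normn_def innern_def L2_set_def power2_eq_square)

lemma normn_nonneg: "normn n x \<ge> 0"
  by (simp add: normn_eq_L2_set L2_set_nonneg)

lemma normn_triangle: "normn n (x + y) \<le> normn n x + normn n y"
  using L2_set_triangle_ineq[of x y "{..<n}"]
  by (simp add: normn_eq_L2_set plus_fun_def)

lemma normn_scaleR: "normn n (c *\<^sub>R x) = \<bar>c\<bar> * normn n x"
proof -
  have "innern n (c *\<^sub>R x) (c *\<^sub>R x) = c\<^sup>2 * innern n x x"
    by (simp add: innern_def sum_distrib_left power2_eq_square algebra_simps)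
  then show ?thesis
    by (simp add: normn_def real_sqrt_mult)
qed

lemma normn_diff_scaleR_le: "normn n (x - c *\<^sub>R y) \<le> normn n x + \<bar>c\<bar> * normn n y"
  using normn_triangle[of n x "(- c) *\<^sub>R y"] normn_scaleR[of n "- c" y] by simp

text \<open>\<open>normn n\<close> sees only the coordinates below \<open>n\<close>; membership in
  \<open>Rn n\<close> makes the remaining ones vanish.\<close>

lemma normn_eq_0_iff:
  assumes "x \<in> Rn n"
  shows "normn n x = 0 \<longleftrightarrow> x = 0"
proof -
  have "normn n x = 0 \<longleftrightarrow> (\<forall>i<n. x i = 0)"
    by (auto simp: normn_eq_L2_set L2_set_eq_0_iff)
  then show ?thesis
    using assms by (metis Rn_iff ext not_le zero_fun_apply)
qed

lemma innern_le_normn: "innern n x y \<le> normn n x * normn n y"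
proof -
  have "innern n x y \<le> (\<Sum>i<n. \<bar>x i\<bar> * \<bar>y i\<bar>)"
    unfolding innern_def by (intro sum_mono) (metis abs_ge_self abs_mult)
  also have "\<dots> \<le> normn n x * normn n y"
    unfolding normn_eq_L2_set by (rule L2_set_mult_ineq)
  finally show ?thesis .
qed

lemma innern_scaleR_right: "innern n x (c *\<^sub>R y) = c * innern n x y"
  by (simp add: innern_def sum_distrib_left algebra_simps)

section \<open>First-order consequences of differentiability and convexity\<close>

text \<open>Pulling the defining limit back along the ray from \<open>x\<close> in direction
  \<open>h\<close> yields one-variable difference quotients, to which minimality and convexity apply
  directly.\<close>

lemma has_gradient_directional:
  assumes x: "x \<in> Rn n" and g: "has_gradient n f g x" and h: "h \<in> Rn n"
  shows "((\<lambda>t. (f (x + t *\<^sub>R h) - f x) / t) \<longlongrightarrow> innern n g h) (at_right 0)"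
proof (cases "h = 0")
  case True
  then show ?thesis by (simp add: innern_def)
next
  case False
  then have pos: "normn n h > 0"
    using normn_eq_0_iff[OF h] normn_nonneg[of n h] by linarith
  \<comment> \<open>The topology here is that of pointwise convergence, so continuity of the ray is
    checked in each coordinate.\<close>
  have "continuous_on UNIV (\<lambda>t::real. x + t *\<^sub>R h)"
    by (intro continuous_on_coordinatewise_then_product) (auto intro!: continuous_intros)
  then have "((\<lambda>t. x + t *\<^sub>R h) \<longlongrightarrow> x + 0 *\<^sub>R h) (at 0)"
    by (simp add: continuous_on_def del: scaleR_zero_left)
  then have "((\<lambda>t. x + t *\<^sub>R h) \<longlongrightarrow> x) (at_right 0)"
    by (auto intro: tendsto_mono[OF at_le])
  moreover have "eventually (\<lambda>t::real. x + t *\<^sub>R h \<in> Rn n \<and> x + t *\<^sub>R h \<noteq> x) (at_right 0)"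
    using x h False by (auto simp: eventually_at_filter Rn_iff)
  ultimately have lim: "filterlim (\<lambda>t. x + t *\<^sub>R h) (at x within Rn n) (at_right 0)"
    by (auto simp: filterlim_at elim: eventually_mono)
  have "((\<lambda>y. (f y - f x - innern n g (y - x)) / normn n (y - x)) \<longlongrightarrow> 0) (at x within Rn n)"
    using g by (simp add: has_gradient_def)
  from filterlim_compose[OF this lim]
  have "((\<lambda>t. (f (x + t *\<^sub>R h) - f x - innern n g (t *\<^sub>R h)) / normn n (t *\<^sub>R h)) \<longlongrightarrow> 0)
      (at_right 0)"
    by simp
  then have "((\<lambda>t. (f (x + t *\<^sub>R h) - f x - innern n g (t *\<^sub>R h)) / normn n (t *\<^sub>R h) * normn n h
      + innern n g h) \<longlongrightarrow> 0 * normn n h + innern n g h) (at_right 0)"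
    by (intro tendsto_intros)
  \<comment> \<open>For \<open>t > 0\<close> the norm of \<open>t *\<^sub>R h\<close> is
    \<open>t * normn n h\<close>. The factor \<open>normn n h\<close> therefore leaves division by
    \<open>t\<close>, and the linear term cancels the added \<open>innern n g h\<close>.\<close>
  moreover have "eventually (\<lambda>t. (f (x + t *\<^sub>R h) - f x - innern n g (t *\<^sub>R h)) / normn n (t *\<^sub>R h)
      * normn n h + innern n g h = (f (x + t *\<^sub>R h) - f x) / t) (at_right 0)"
    using pos by (auto simp: eventually_at_filter normn_scaleR innern_scaleR_right field_simps)
  ultimately show ?thesis
    by (simp add: Lim_transform_eventually)
qed

text \<open>Leaving the minimizer in direction \<open>-g\<close> gives nonnegative difference
  quotients, whose limit is minus the squared norm of \<open>g\<close>.\<close>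

lemma gradient_minimizer:
  assumes g: "has_gradient n f g xs" and m: "is_minimizer n f xs"
  shows "g = 0"
proof -
  have xs: "xs \<in> Rn n" and min: "\<And>x. x \<in> Rn n \<Longrightarrow> f xs \<le> f x"
    using m by (auto simp: is_minimizer_def)
  have gR: "g \<in> Rn n"
    using g by (simp add: has_gradient_def)
  have h: "(-1) *\<^sub>R g \<in> Rn n"
    using gR by (rule Rn_scaleR)
  have "eventually (\<lambda>t. 0 \<le> (f (xs + t *\<^sub>R ((-1) *\<^sub>R g)) - f xs) / t) (at_right 0)"
    using min[OF Rn_add[OF xs Rn_scaleR[OF h]]] by (simp add: eventually_at_filter)
  then have "0 \<le> innern n g ((-1) *\<^sub>R g)"
    by (rule tendsto_lowerbound[OF has_gradient_directional[OF xs g h]]) simp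
  then have "innern n g g \<le> 0"
    using innern_scaleR_right[of n g "-1" g] by linarith
  then have "normn n g \<le> 0"
    by (simp add: normn_def)
  then show ?thesis
    using normn_eq_0_iff[OF gR] normn_nonneg[of n g] by simp
qed

text \<open>Convexity bounds the secant slopes from \<open>x\<close> towards \<open>u\<close> by
  \<open>f u - f x\<close> for \<open>0 < t < 1\<close>; letting \<open>t\<close> tend to 0 turns
  them into the directional derivative.\<close>

lemma convex_on_gradient_le:
  assumes x: "x \<in> Rn n" and u: "u \<in> Rn n" and g: "has_gradient n f g x"
    and c: "convex_on (Rn n) f"
  shows "f x + innern n g (u - x) \<le> f u"
proof -
  have "(f (x + t *\<^sub>R (u - x)) - f x) / t \<le> f u - f x" if "0 < t" "t < 1" for t
  proof -
    have "f ((1 - t) *\<^sub>R x + t *\<^sub>R u) \<le> (1 - t) * f x + t * f u"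
      using that by (intro convex_onD[OF c _ _ x u]) auto
    moreover have "(1 - t) *\<^sub>R x + t *\<^sub>R u = x + t *\<^sub>R (u - x)"
      by (simp add: algebra_simps)
    ultimately show ?thesis
      using that by (simp add: field_simps)
  qed
  then have "eventually (\<lambda>t. (f (x + t *\<^sub>R (u - x)) - f x) / t \<le> f u - f x) (at_right 0)"
    by (auto simp: eventually_at_right_field intro!: exI[of _ 1])
  then have "innern n g (u - x) \<le> f u - f x"
    by (rule tendsto_upperbound[OF has_gradient_directional[OF x g Rn_diff[OF u x]]]) simp
  then show ?thesis by simp
qed

section \<open>Scaled gradient and function value bounds on the class \<open>F1\<close>\<close>

text \<open>Existence together with uniqueness ensures that the definite description
  \<open>gradient\<close> denotes an actual gradient.\<close>

lemma F1_has_gradient: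
  assumes "f \<in> F1 n L" "x \<in> Rn n"
  shows "has_gradient n f (gradient n f x) x"
  using assms gradient_eqI unfolding F1_def C1_function_def by blast

lemma F1_gradient_in_Rn: "f \<in> F1 n L \<Longrightarrow> x \<in> Rn n \<Longrightarrow> gradient n f x \<in> Rn n"
  using F1_has_gradient by (simp add: has_gradient_def)

lemma F1_gradient_le:
  assumes f: "f \<in> F1 n L" and m: "is_minimizer n f xs" and x: "x \<in> Rn n"
  shows "normn n (gradient n f x) \<le> L * normn n (x - xs)"
proof -
  have xs: "xs \<in> Rn n"
    using m by (simp add: is_minimizer_def)
  have "gradient n f xs = 0"
    using gradient_minimizer[OF F1_has_gradient[OF f xs] m] .
  moreover have "normn n (gradient n f x - gradient n f xs) \<le> L * normn n (x - xs)"
    using f x xs by (auto simp: F1_def)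
  ultimately show ?thesis by simp
qed

text \<open>The step size condition says \<open>s * L \<le> C\<^sub>0\<close>, which removes both
  \<open>L\<close> and \<open>s\<close> from the constant.\<close>

lemma F1_scaled_gradient_le:
  assumes "f \<in> F1 n L" "is_minimizer n f xs" "x \<in> Rn n" and L: "L > 0" and s: "0 < s" "s \<le> C\<^sub>0 / L"
  shows "s * normn n (gradient n f x) \<le> C\<^sub>0 * normn n (x - xs)"
proof -
  have "s * normn n (gradient n f x) \<le> s * (L * normn n (x - xs))"
    using F1_gradient_le[OF assms(1-3)] s by simp
  also have "\<dots> = (s * L) * normn n (x - xs)"
    by simp
  also have "\<dots> \<le> C\<^sub>0 * normn n (x - xs)"
    using s L by (intro mult_right_mono normn_nonneg) (simp add: field_simps)
  finally show ?thesis .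
qed

text \<open>The single factor \<open>s\<close> is absorbed by the gradient factor of the
  Cauchy-Schwarz product, so the square of the distance remains.\<close>

lemma F1_scaled_value_le:
  assumes f: "f \<in> F1 n L" and m: "is_minimizer n f xs" and x: "x \<in> Rn n"
    and L: "L > 0" and s: "0 < s" "s \<le> C\<^sub>0 / L"
  shows "s * (f x - f xs) \<le> C\<^sub>0 * (normn n (x - xs))\<^sup>2"
proof -
  have xs: "xs \<in> Rn n"
    using m by (simp add: is_minimizer_def)
  have "f x + innern n (gradient n f x) (xs - x) \<le> f xs"
    using f by (intro convex_on_gradient_le[OF x xs F1_has_gradient[OF f x]]) (simp add: F1_def)
  moreover have "innern n (gradient n f x) (xs - x) = - innern n (gradient n f x) (x - xs)"
    using innern_scaleR_right[of n "gradient n f x" "-1" "x - xs"] by simp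
  ultimately have "f x - f xs \<le> innern n (gradient n f x) (x - xs)"
    by simp
  also have "\<dots> \<le> normn n (gradient n f x) * normn n (x - xs)"
    by (rule innern_le_normn)
  finally have "s * (f x - f xs) \<le> (s * normn n (gradient n f x)) * normn n (x - xs)"
    using s by simp
  also have "\<dots> \<le> (C\<^sub>0 * normn n (x - xs)) * normn n (x - xs)"
    using F1_scaled_gradient_le[OF assms] by (intro mult_right_mono normn_nonneg)
  finally show ?thesis
    by (simp add: power2_eq_square algebra_simps)
qed

section \<open>Growth of the iterates over finitely many steps\<close>

text \<open>The gradient estimates hold on \<open>Rn n\<close> only. The claim leaves out
  \<open>y\<close>, since \<open>y 0\<close> is arbitrary; \<open>y (Suc k)\<close> is recovered
  from \<open>x k\<close> inside the induction step.\<close>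

lemma iterates_B'_in_Rn:
  assumes it: "iterates_B' n \<alpha> \<beta> \<gamma> s f x y z" and f: "f \<in> F1 n L"
  shows "x k \<in> Rn n \<and> z k \<in> Rn n"
proof (induction k)
  case 0
  then show ?case using it by (simp add: iterates_B'_def)
next
  case (Suc k)
  then have g: "gradient n f (x k) \<in> Rn n"
    using F1_gradient_in_Rn[OF f] by blast
  have "z (Suc k) \<in> Rn n" "y (Suc k) \<in> Rn n"
    using it Suc g by (auto simp: iterates_B'_def simp del: scaleR_fun_apply intro!: Rn_diff Rn_scaleR)
  moreover have "x (Suc k) = (1 / \<alpha> (Suc k)) *\<^sub>R z (Suc k) + (1 - 1 / \<alpha> (Suc k)) *\<^sub>R y (Suc k)"
    using it by (simp add: iterates_B'_def)
  ultimately show ?case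
    by (metis Rn_add Rn_scaleR)
qed

text \<open>Covers both gradient updates: \<open>w = x k\<close> with \<open>c = \<beta> k\<close>
  gives \<open>y (Suc k)\<close>, and \<open>w = z k\<close> with
  \<open>c = alpha_tilde \<alpha> \<beta> \<gamma> k\<close> gives \<open>z (Suc k)\<close>.\<close>

lemma gradient_step_le:
  assumes s: "0 < s" and G: "s * normn n g \<le> C\<^sub>0 * normn n (x - xs)"
    and x: "normn n (x - xs) \<le> D * r" and w: "normn n (w - xs) \<le> D * r" and C\<^sub>0: "C\<^sub>0 > 0"
  shows "normn n (w - (c * s) *\<^sub>R g - xs) \<le> (1 + \<bar>c\<bar> * C\<^sub>0) * D * r"
proof -
  have "normn n (w - (c * s) *\<^sub>R g - xs) = normn n ((w - xs) - (c * s) *\<^sub>R g)"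
    by (rule arg_cong[where f = "normn n"]) (simp add: fun_eq_iff)
  also have "\<dots> \<le> normn n (w - xs) + \<bar>c * s\<bar> * normn n g"
    by (rule normn_diff_scaleR_le)
  finally have "normn n (w - (c * s) *\<^sub>R g - xs) \<le> normn n (w - xs) + \<bar>c * s\<bar> * normn n g" .
  moreover have "\<bar>c * s\<bar> * normn n g = \<bar>c\<bar> * (s * normn n g)"
    using s by (simp add: abs_mult)
  moreover have "\<bar>c\<bar> * (s * normn n g) \<le> \<bar>c\<bar> * (C\<^sub>0 * (D * r))"
    using C\<^sub>0 x by (intro mult_left_mono order.trans[OF G]) auto
  moreover have "(1 + \<bar>c\<bar> * C\<^sub>0) * D * r = D * r + \<bar>c\<bar> * (C\<^sub>0 * (D * r))"
    by (simp add: distrib_right)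
  ultimately show ?thesis
    using w by linarith
qed

text \<open>The existential stands before all problem data, so the induction itself delivers a
  uniform constant, which may grow with \<open>k\<close>. The bounds on \<open>x\<close> and
  \<open>z\<close> are carried together because the recursion couples them.\<close>

lemma iterates_B'_bounded:
  fixes C\<^sub>0 :: real and \<alpha> \<beta> \<gamma> :: "nat \<Rightarrow> real"
  assumes C\<^sub>0: "C\<^sub>0 > 0"
  shows "\<exists>D\<ge>0. \<forall>n L f xs s x y z.
    L > 0 \<longrightarrow> f \<in> F1 n L \<longrightarrow> is_minimizer n f xs \<longrightarrow> 0 < s \<longrightarrow> s \<le> C\<^sub>0 / L \<longrightarrow>
    iterates_B' n \<alpha> \<beta> \<gamma> s f x y z \<longrightarrow>
      normn n (x k - xs) \<le> D * normn n (x 0 - xs) \<and> normn n (z k - xs) \<le> D * normn n (x 0 - xs)"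
proof (induction k)
  case 0
  show ?case
    \<comment> \<open>The witness 1 works for both bounds because \<open>z 0 = x 0\<close>.\<close>
    by (rule exI[of _ 1]) (auto simp: iterates_B'_def)
next
  case (Suc k)
  then obtain D where D: "D \<ge> 0" and IH: "\<And>n L f xs s x y z.
    \<lbrakk>L > 0; f \<in> F1 n L; is_minimizer n f xs; 0 < s; s \<le> C\<^sub>0 / L; iterates_B' n \<alpha> \<beta> \<gamma> s f x y z\<rbrakk> \<Longrightarrow>
      normn n (x k - xs) \<le> D * normn n (x 0 - xs) \<and> normn n (z k - xs) \<le> D * normn n (x 0 - xs)"
    by blast
  define a where "a = 1 / \<alpha> (Suc k)"
  define Dz where "Dz = (1 + \<bar>alpha_tilde \<alpha> \<beta> \<gamma> k\<bar> * C\<^sub>0) * D"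
  define Dy where "Dy = (1 + \<bar>\<beta> k\<bar> * C\<^sub>0) * D"
  \<comment> \<open>The first summand alone covers \<open>z (Suc k)\<close>; the bracket covers
    \<open>x (Suc k)\<close>.\<close>
  define D' where "D' = Dz + (\<bar>a\<bar> * Dz + \<bar>1 - a\<bar> * Dy)"
  have nonneg: "Dz \<ge> 0" "Dy \<ge> 0"
    using D C\<^sub>0 by (simp_all add: Dz_def Dy_def)
  have "normn n (x (Suc k) - xs) \<le> D' * normn n (x 0 - xs) \<and>
        normn n (z (Suc k) - xs) \<le> D' * normn n (x 0 - xs)"
    if L: "L > 0" and f: "f \<in> F1 n L" and m: "is_minimizer n f xs" and s: "0 < s" "s \<le> C\<^sub>0 / L"
      and it: "iterates_B' n \<alpha> \<beta> \<gamma> s f x y z" for n L f xs s x y z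
  proof -
    define r where "r = normn n (x 0 - xs)"
    have r: "r \<ge> 0"
      by (simp add: r_def normn_nonneg)
    have b: "normn n (x k - xs) \<le> D * r" "normn n (z k - xs) \<le> D * r"
      using IH[OF L f m s it] by (simp_all add: r_def)
    have G: "s * normn n (gradient n f (x k)) \<le> C\<^sub>0 * normn n (x k - xs)"
      using F1_scaled_gradient_le[OF f m _ L s] iterates_B'_in_Rn[OF it f] by blast
    have z: "normn n (z (Suc k) - xs) \<le> Dz * r"
      using gradient_step_le[OF s(1) G b C\<^sub>0] it by (simp add: iterates_B'_def Dz_def)
    have y: "normn n (y (Suc k) - xs) \<le> Dy * r"
      using gradient_step_le[OF s(1) G b(1) b(1) C\<^sub>0] it by (simp add: iterates_B'_def Dy_def)
    \<comment> \<open>The weights sum to 1, so \<open>xs\<close> can be subtracted from each point.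
      They may be negative, hence the absolute values in the estimate that follows.\<close>
    have "x (Suc k) - xs = a *\<^sub>R (z (Suc k) - xs) + (1 - a) *\<^sub>R (y (Suc k) - xs)"
    proof -
      have "x (Suc k) = a *\<^sub>R z (Suc k) + (1 - a) *\<^sub>R y (Suc k)"
        using it by (simp add: iterates_B'_def a_def)
      then show ?thesis
        by (simp only:) (simp add: algebra_simps)
    qed
    then have "normn n (x (Suc k) - xs) \<le>
        \<bar>a\<bar> * normn n (z (Suc k) - xs) + \<bar>1 - a\<bar> * normn n (y (Suc k) - xs)"
      by (metis normn_triangle normn_scaleR)
    also have "\<dots> \<le> \<bar>a\<bar> * (Dz * r) + \<bar>1 - a\<bar> * (Dy * r)"
      using y z by (intro add_mono mult_left_mono) auto
    also have "\<dots> \<le> D' * r"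
      using nonneg r by (simp add: D'_def algebra_simps)
    finally have "normn n (x (Suc k) - xs) \<le> D' * r" .
    moreover have "Dz * r \<le> D' * r"
      using nonneg r by (intro mult_right_mono) (auto simp: D'_def)
    ultimately show ?thesis
      using z unfolding r_def by linarith
  qed
  moreover have "D' \<ge> 0"
    using nonneg by (simp add: D'_def)
  ultimately show ?case by blast
qed

theorem lemmaS3:
  fixes C\<^sub>0 :: real and K :: nat and \<alpha> \<beta> \<gamma> :: "nat \<Rightarrow> real"
  assumes "C\<^sub>0 > 0" and "\<And>k. \<alpha> k \<noteq> 0"
  shows "\<exists>C>0. \<forall>n L f xs s x y z.
    L > 0 \<longrightarrow> f \<in> F1 n L \<longrightarrow> is_minimizer n f xs \<longrightarrow> 0 < s \<longrightarrow> s \<le> C\<^sub>0 / L \<longrightarrow>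
    iterates_B' n \<alpha> \<beta> \<gamma> s f x y z \<longrightarrow>
      s * (f (x K) - f xs) \<le> C * (normn n (x 0 - xs))\<^sup>2 \<and>
      s\<^sup>2 * (normn n (gradient n f (x K)))\<^sup>2 \<le> C * (normn n (x 0 - xs))\<^sup>2 \<and>
      (normn n (z (Suc K) - xs))\<^sup>2 \<le> C * (normn n (x 0 - xs))\<^sup>2"
proof -
  obtain D where D: "D \<ge> 0" and xK: "\<And>n L f xs s x y z.
    \<lbrakk>L > 0; f \<in> F1 n L; is_minimizer n f xs; 0 < s; s \<le> C\<^sub>0 / L; iterates_B' n \<alpha> \<beta> \<gamma> s f x y z\<rbrakk> \<Longrightarrow>
      normn n (x K - xs) \<le> D * normn n (x 0 - xs)"
    using iterates_B'_bounded[OF assms(1), of \<alpha> \<beta> \<gamma> K] by blast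
  \<comment> \<open>A second constant, at index \<open>Suc K\<close>, because the third estimate
    concerns \<open>z\<close> one step later.\<close>
  obtain E where E: "E \<ge> 0" and zK: "\<And>n L f xs s x y z.
    \<lbrakk>L > 0; f \<in> F1 n L; is_minimizer n f xs; 0 < s; s \<le> C\<^sub>0 / L; iterates_B' n \<alpha> \<beta> \<gamma> s f x y z\<rbrakk> \<Longrightarrow>
      normn n (z (Suc K) - xs) \<le> E * normn n (x 0 - xs)"
    using iterates_B'_bounded[OF assms(1), of \<alpha> \<beta> \<gamma> "Suc K"] by blast
  \<comment> \<open>The last three summands serve the function value, the gradient and
    \<open>z\<close> in this order; the 1 keeps \<open>C\<close> positive even if \<open>D\<close>
    and \<open>E\<close> vanish.\<close>
  define C where "C = 1 + C\<^sub>0 * D\<^sup>2 + (C\<^sub>0 * D)\<^sup>2 + E\<^sup>2"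
  have C: "C > 0" "C\<^sub>0 * D\<^sup>2 \<le> C" "(C\<^sub>0 * D)\<^sup>2 \<le> C" "E\<^sup>2 \<le> C"
  proof -
    have "C\<^sub>0 * D\<^sup>2 \<ge> 0" "(C\<^sub>0 * D)\<^sup>2 \<ge> 0" "E\<^sup>2 \<ge> 0"
      using assms(1) by simp_all
    then show "C > 0" "C\<^sub>0 * D\<^sup>2 \<le> C" "(C\<^sub>0 * D)\<^sup>2 \<le> C" "E\<^sup>2 \<le> C"
      unfolding C_def by linarith+
  qed
  have "s * (f (x K) - f xs) \<le> C * (normn n (x 0 - xs))\<^sup>2 \<and>
      s\<^sup>2 * (normn n (gradient n f (x K)))\<^sup>2 \<le> C * (normn n (x 0 - xs))\<^sup>2 \<and>
      (normn n (z (Suc K) - xs))\<^sup>2 \<le> C * (normn n (x 0 - xs))\<^sup>2"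
    if L: "L > 0" and f: "f \<in> F1 n L" and m: "is_minimizer n f xs" and s: "0 < s" "s \<le> C\<^sub>0 / L"
      and it: "iterates_B' n \<alpha> \<beta> \<gamma> s f x y z" for n L f xs s x y z
  proof -
    define r where "r = normn n (x 0 - xs)"
    have xR: "x K \<in> Rn n"
      using iterates_B'_in_Rn[OF it f] by blast
    have bx: "normn n (x K - xs) \<le> D * r" and bz: "normn n (z (Suc K) - xs) \<le> E * r"
      using xK[OF L f m s it] zK[OF L f m s it] by (simp_all add: r_def)
    have "s * (f (x K) - f xs) \<le> C\<^sub>0 * (normn n (x K - xs))\<^sup>2"
      by (rule F1_scaled_value_le[OF f m xR L s])
    also have "\<dots> \<le> C\<^sub>0 * (D * r)\<^sup>2"
      using assms(1) bx by (intro mult_left_mono power_mono normn_nonneg) auto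
    also have "\<dots> = C\<^sub>0 * D\<^sup>2 * r\<^sup>2"
      by (simp add: power_mult_distrib)
    also have "\<dots> \<le> C * r\<^sup>2"
      using C by (intro mult_right_mono) auto
    finally have 1: "s * (f (x K) - f xs) \<le> C * r\<^sup>2" .
    have "s * normn n (gradient n f (x K)) \<le> C\<^sub>0 * normn n (x K - xs)"
      by (rule F1_scaled_gradient_le[OF f m xR L s])
    also have "\<dots> \<le> C\<^sub>0 * (D * r)"
      using assms(1) bx by simp
    finally have "(s * normn n (gradient n f (x K)))\<^sup>2 \<le> (C\<^sub>0 * (D * r))\<^sup>2"
      using s by (intro power_mono) (auto simp: normn_nonneg)
    also have "\<dots> = (C\<^sub>0 * D)\<^sup>2 * r\<^sup>2"
      by (simp add: power_mult_distrib)
    also have "\<dots> \<le> C * r\<^sup>2"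
      using C by (intro mult_right_mono) auto
    finally have 2: "s\<^sup>2 * (normn n (gradient n f (x K)))\<^sup>2 \<le> C * r\<^sup>2"
      by (simp add: power_mult_distrib)
    have "(normn n (z (Suc K) - xs))\<^sup>2 \<le> (E * r)\<^sup>2"
      using bz by (intro power_mono normn_nonneg)
    also have "\<dots> = E\<^sup>2 * r\<^sup>2"
      by (simp add: power_mult_distrib)
    also have "\<dots> \<le> C * r\<^sup>2"
      using C by (intro mult_right_mono) auto
    finally show ?thesis
      using 1 2 by (simp add: r_def)
  qed
  then show ?thesis
    using C(1) by blast
qed

end
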